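(* Let $n,m,N,M$ be positive integers and let $f,\tilde f$ be the functions representing a continuous image and its corrupted version: either both are functions $]-1,1[^2\to\mathbb{R}$ (gray-level case) or both are functions $]-1,1[^2\to\mathbb{R}^3$ (RGB color case). Let $I$, $I^{in}$ (of size $n\times m$) and $I^{res}$, $I^{out}$ (of size $N\times M$) be the associated digital images defined in the context, i.e. $I$ and $I^{in}$ are the samples of $f$ and $\tilde f$, respectively, at the Chebyshev grid $X_{n\times m}$, $I^{res}$ is made of the samples of $f$ at the Chebyshev grid $X_{N\times M}$, and $I^{out}$ is made of the samples at $X_{N\times M}$ of the tensor product Lagrange polynomial $L_{n,m}\tilde f$ interpolating $\tilde f$ at $X_{n\times m}$. If there exists $\ell\in\mathbb{N}$ such that $n=(2\ell-1)N$ and $m=(2\ell-1)M$, then $$\mathrm{MSE}(I^{res},I^{out})\le s^2\,\mathrm{MSE}(I,I^{in}),\qquad s:=2\ell-1.$$ Moreover, if in addition $I=I^{in}$, then $$\mathrm{MSE}(I^{res},I^{out})=0\qquad\text{and}\qquad \mathrm{SSIM}(I^{res},I^{out})=1.$$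
   Context: Here $\mathbb{N}=\{1,2,\dots\}$. For $\mu\in\mathbb{N}$ the first kind Chebyshev zeros are $x_k^\mu=\cos\left[\frac{(2k-1)\pi}{2\mu}\right]$, $k=1,\dots,\mu$, and for $p,q\in\mathbb{N}$ the grid is $X_{p\times q}=\{(x_i^p,x_j^q): i=1,\dots,p,\ j=1,\dots,q\}$. Fundamental Lagrange polynomials: $\ell_k^\mu(\xi)=\prod_{s=1,\,s\neq k}^{\mu}\frac{\xi-x_s^\mu}{x_k^\mu-x_s^\mu}$. For a scalar function $g$ on $]-1,1[^2$, $L_{n,m}g(x,y)=\sum_{i=1}^n\sum_{j=1}^m g(x_i^n,x_j^m)\,\ell_i^n(x)\,\ell_j^m(y)$. For $\mathbb{R}^3$-valued $g=(g_R,g_G,g_B)$, $L_{n,m}g$ is defined componentwise. Images: $I_{i,j}=f(x_i^n,x_j^m)$ and $I^{in}_{i,j}=\tilde f(x_i^n,x_j^m)$ for $i=1,\dots,n$, $j=1,\dots,m$; $I^{res}_{k,h}=f(x_k^N,x_h^M)$ and $I^{out}_{k,h}=L_{n,m}\tilde f(x_k^N,x_h^M)$ for $k=1,\dots,N$, $h=1,\dots,M$. In the gray-level case these are real matrices; in the RGB case each image is a triple of real matrices (its R, G, B components), e.g. $I=(I_R,I_G,I_B)$. Mean squared error: for two gray-level images $A,B\in\mathbb{R}^{p\times q}$, $\mathrm{MSE}(A,B)=\frac{1}{pq}\|A-B\|_F^2$, with $\|\cdot\|_F$ the Frobenius norm. For two RGB images of $p\times q$ pixels, $\mathrm{MSE}(A,B)=\frac{1}{3pq}\left(\|A_R-B_R\|_F^2+\|A_G-B_G\|_F^2+\|A_B-B_B\|_F^2\right)$.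 Structured similarity index: for gray-level images $A,B\in\mathbb{R}^{p\times q}$, $$\mathrm{SSIM}(A,B)=\frac{[2\mu(A)\mu(B)+c_1]\,[2\,\mathrm{cov}(A,B)+c_2]}{[\mu^2(A)+\mu^2(B)+c_1]\,[\sigma^2(A)+\sigma^2(B)+c_2]},$$ where $\mu(A)$ is the average of the entries of $A$, $\mathrm{cov}(A,B)=\frac1{pq}\sum_{k,h}(A_{k,h}-\mu(A))(B_{k,h}-\mu(B))$ is the covariance, $\sigma^2(A)=\mathrm{cov}(A,A)$ is the variance, and $c_1,c_2$ are the positive constants $c_1=0.01\,L$, $c_2=0.03\,L$ with $L=255$. For RGB images, $\mathrm{SSIM}$ is computed by applying this formula to the luma (Y) channels of the two images after the standard conversion to the YCbCr color space; the Y channel is obtained by applying one fixed affine function $\mathbb{R}^3\to\mathbb{R}$ to the RGB values at each pixel. *)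

theory Defs
  imports "HOL-Analysis.Product_Vector" "Jordan_Normal_Form.Matrix"
begin

definition cheb_zero :: "nat \<Rightarrow> nat \<Rightarrow> real" where
  "cheb_zero \<mu> k = cos ((2 * real k - 1) * pi / (2 * real \<mu>))"

definition lagrange_basis :: "nat \<Rightarrow> nat \<Rightarrow> real \<Rightarrow> real" where
  "lagrange_basis \<mu> k \<xi> =
     (\<Prod>s \<in> {1..\<mu>} - {k}. (\<xi> - cheb_zero \<mu> s) / (cheb_zero \<mu> k - cheb_zero \<mu> s))"

text \<open>
  Functions on the open square \<open>]-1,1[\<^sup>2\<close> are represented by total functions on
  \<open>\<real>\<^sup>2\<close>. They are only ever evaluated at Chebyshev grid points, which lie in
  the open square, so the values outside of it play no role.
\<close>

definition lagrange_interp :: "nat \<Rightarrow> nat \<Rightarrow> (real \<times> real \<Rightarrow> real) \<Rightarrow> real \<times> real \<Rightarrow> real" where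
  "lagrange_interp n m g = (\<lambda>(x, y).
     \<Sum>i = 1..n. \<Sum>j = 1..m.
       g (cheb_zero n i, cheb_zero m j) * lagrange_basis n i x * lagrange_basis m j y)"

type_synonym rgb = "real \<times> real \<times> real"

definition red :: "rgb \<Rightarrow> real" where "red = (\<lambda>(r, g, b). r)"
definition green :: "rgb \<Rightarrow> real" where "green = (\<lambda>(r, g, b). g)"
definition blue :: "rgb \<Rightarrow> real" where "blue = (\<lambda>(r, g, b). b)"

definition lagrange_interp_rgb :: "nat \<Rightarrow> nat \<Rightarrow> (real \<times> real \<Rightarrow> rgb) \<Rightarrow> real \<times> real \<Rightarrow> rgb" where
  "lagrange_interp_rgb n m g = (\<lambda>z.
     (lagrange_interp n m (red \<circ> g) z,
      lagrange_interp n m (green \<circ> g) z,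
      lagrange_interp n m (blue \<circ> g) z))"

type_synonym gray_image = "real mat"
type_synonym rgb_image = "real mat \<times> real mat \<times> real mat"

text \<open>
  Matrix entries are indexed from 0, whereas the Chebyshev zeros are indexed from 1.
\<close>

definition sample :: "nat \<Rightarrow> nat \<Rightarrow> (real \<times> real \<Rightarrow> real) \<Rightarrow> gray_image" where
  "sample p q g = mat p q (\<lambda>(i, j). g (cheb_zero p (i + 1), cheb_zero q (j + 1)))"

definition sample_rgb :: "nat \<Rightarrow> nat \<Rightarrow> (real \<times> real \<Rightarrow> rgb) \<Rightarrow> rgb_image" where
  "sample_rgb p q g =
     (sample p q (red \<circ> g), sample p q (green \<circ> g), sample p q (blue \<circ> g))"

definition frobenius_norm :: "real mat \<Rightarrow> real" where
  "frobenius_norm A = sqrt (\<Sum>i<dim_row A. \<Sum>j<dim_col A. (A $$ (i, j))\<^sup>2)"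

definition MSE :: "gray_image \<Rightarrow> gray_image \<Rightarrow> real" where
  "MSE A B = 1 / (real (dim_row A) * real (dim_col A)) * (frobenius_norm (A - B))\<^sup>2"

definition MSE_rgb :: "rgb_image \<Rightarrow> rgb_image \<Rightarrow> real" where
  "MSE_rgb = (\<lambda>(AR, AG, AB) (BR, BG, BB).
     1 / (3 * real (dim_row AR) * real (dim_col AR)) *
       ((frobenius_norm (AR - BR))\<^sup>2 + (frobenius_norm (AG - BG))\<^sup>2
         + (frobenius_norm (AB - BB))\<^sup>2))"

definition img_mean :: "gray_image \<Rightarrow> real" where
  "img_mean A =
     1 / (real (dim_row A) * real (dim_col A)) * (\<Sum>k<dim_row A. \<Sum>h<dim_col A. A $$ (k, h))"

definition img_cov :: "gray_image \<Rightarrow> gray_image \<Rightarrow> real" where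
  "img_cov A B =
     1 / (real (dim_row A) * real (dim_col A)) *
       (\<Sum>k<dim_row A. \<Sum>h<dim_col A. (A $$ (k, h) - img_mean A) * (B $$ (k, h) - img_mean B))"

definition img_var :: "gray_image \<Rightarrow> real" where
  "img_var A = img_cov A A"

definition ssim_c1 :: real where "ssim_c1 = 0.01 * 255"
definition ssim_c2 :: real where "ssim_c2 = 0.03 * 255"

definition SSIM :: "gray_image \<Rightarrow> gray_image \<Rightarrow> real" where
  "SSIM A B =
     ((2 * img_mean A * img_mean B + ssim_c1) * (2 * img_cov A B + ssim_c2)) /
     (((img_mean A)\<^sup>2 + (img_mean B)\<^sup>2 + ssim_c1) * (img_var A + img_var B + ssim_c2))"

definition affine_function :: "(rgb \<Rightarrow> real) \<Rightarrow> bool" where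
  "affine_function Y \<longleftrightarrow> (\<exists>h c. linear h \<and> (\<forall>v. Y v = h v + c))"

text \<open>
  The conversion to YCbCr enters only through its luma component
  \<open>Y :: rgb \<Rightarrow> real\<close>, an affine function that is kept as a parameter, since its
  coefficients depend on the convention (full or studio range, choice of the standard).
\<close>

definition luma_channel :: "(rgb \<Rightarrow> real) \<Rightarrow> rgb_image \<Rightarrow> gray_image" where
  "luma_channel Y = (\<lambda>(R, G, B).
     mat (dim_row R) (dim_col R) (\<lambda>ij. Y (R $$ ij, G $$ ij, B $$ ij)))"

definition SSIM_rgb :: "(rgb \<Rightarrow> real) \<Rightarrow> rgb_image \<Rightarrow> rgb_image \<Rightarrow> real" where
  "SSIM_rgb Y A B = SSIM (luma_channel Y A) (luma_channel Y B)"

end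

theory Submission
  imports Defs
begin

text \<open>
  Since \<open>s\<close> is odd, every Chebyshev zero of order \<open>N\<close> is also one of order
  \<open>s N\<close>: with indices from 0, the zero with index \<open>k\<close> reappears with index
  \<open>s k + (s - 1) / 2\<close>. So the output pixels lie on the interpolation grid, where the
  interpolant agrees with the corrupted image. Hence the output error is a sum over a subset of
  the terms of the input error, and the factor \<open>s\<^sup>2\<close> is the ratio of the numbers of pixels.
\<close>

text \<open>The angles for indices 1 to \<open>\<mu>\<close> lie in \<open>{0..pi}\<close>, where
  cosine is injective. Distinct nodes keep the denominators of \<open>lagrange_basis\<close>
  nonzero.\<close>

lemma inj_on_cheb_zero: "inj_on (cheb_zero \<mu>) {1..\<mu>}"
proof (rule inj_onI)
  fix i j assume ij: "i \<in> {1..\<mu>}" "j \<in> {1..\<mu>}" and eq: "cheb_zero \<mu> i = cheb_zero \<mu> j"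
  have range: "(2 * real k - 1) * pi / (2 * real \<mu>) \<in> {0..pi}" if "k \<in> {1..\<mu>}" for k
  proof -
    have "(2 * real k - 1) * pi \<le> (2 * real \<mu>) * pi"
      using that by (intro mult_right_mono) auto
    then show ?thesis using that by (auto simp: field_simps)
  qed
  have "(2 * real i - 1) * pi / (2 * real \<mu>) = (2 * real j - 1) * pi / (2 * real \<mu>)"
    using range[OF ij(1)] range[OF ij(2)] eq
    unfolding cheb_zero_def atLeastAtMost_iff by (elim conjE) (rule cos_inj_pi)
  moreover have "\<mu> \<noteq> 0" using ij by auto
  ultimately show "i = j" by simp
qed

lemma lagrange_basis_cheb_zero:
  assumes "i \<in> {1..\<mu>}" "k \<in> {1..\<mu>}"
  shows "lagrange_basis \<mu> i (cheb_zero \<mu> k) = (if i = k then 1 else 0)"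
proof (cases "i = k")
  case True
  \<comment> \<open>This rules out 0 / 0, which is 0 in HOL, so every factor of the product is
    1.\<close>
  have "cheb_zero \<mu> k \<noteq> cheb_zero \<mu> t" if "t \<in> {1..\<mu>} - {k}" for t
    using inj_on_cheb_zero[of \<mu>] assms that by (auto dest: inj_onD)
  then show ?thesis
    using True by (auto simp: lagrange_basis_def intro!: prod.neutral)
next
  case False
  then show ?thesis
    \<comment> \<open>The factor with index \<open>k\<close> has numerator 0, and it occurs in the
      product because \<open>i\<close> differs from \<open>k\<close>.\<close>
    using assms by (auto simp: lagrange_basis_def intro!: prod_zero bexI[of _ k])
qed

lemma lagrange_interp_cheb_zero:
  assumes "k \<in> {1..n}" "h \<in> {1..m}"
  shows "lagrange_interp n m g (cheb_zero n k, cheb_zero m h) = g (cheb_zero n k, cheb_zero m h)"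
proof -
  \<comment> \<open>Nested conditionals in place of a product of deltas let the inner sum collapse
    first, then the outer one.\<close>
  have "lagrange_interp n m g (cheb_zero n k, cheb_zero m h) =
      (\<Sum>i = 1..n. \<Sum>j = 1..m.
        if i = k then if j = h then g (cheb_zero n i, cheb_zero m j) else 0 else 0)"
    unfolding lagrange_interp_def prod.case
    using assms by (intro sum.cong refl) (simp add: lagrange_basis_cheb_zero)
  also have "\<dots> = (\<Sum>i = 1..n. if i = k then g (cheb_zero n i, cheb_zero m h) else 0)"
    using assms by (intro sum.cong refl) simp
  also have "\<dots> = g (cheb_zero n k, cheb_zero m h)"
    using assms by simp
  finally show ?thesis .
qed

text \<open>For \<open>s = 2 * t + 1\<close> one has
  \<open>2 * (s * k + t + 1) - 1 = s * (2 * k + 1)\<close>, so numerator and denominator of the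
  angle both gain the factor \<open>s\<close>. \<open>Suc\<close> passes from matrix indices to node
  indices.\<close>

lemma cheb_zero_odd_multiple:
  assumes "odd s"
  shows "cheb_zero (s * N) (Suc (s * k + s div 2)) = cheb_zero N (Suc k)"
proof -
  have "s > 0" using assms by (auto intro: Nat.gr0I)
  have "2 * real (Suc (s * k + s div 2)) - 1 = real s * (2 * real (Suc k) - 1)"
    using assms by (auto elim!: oddE simp: algebra_simps)
  then have "cheb_zero (s * N) (Suc (s * k + s div 2))
      = cos (real s * ((2 * real (Suc k) - 1) * pi) / (real s * (2 * real N)))"
    by (simp only: cheb_zero_def of_nat_mult mult.assoc mult.left_commute[of 2])
  also have "\<dots> = cheb_zero N (Suc k)"
    unfolding cheb_zero_def using \<open>s > 0\<close> by (subst mult_divide_mult_cancel_left) simp_all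
  finally show ?thesis .
qed

text \<open>Block \<open>k\<close> of the fine indices runs from \<open>s * k\<close> to
  \<open>s * k + s - 1\<close>, and \<open>s * k + s div 2\<close> is its middle.\<close>

lemma odd_multiple_index_less:
  fixes k s N :: nat
  assumes "odd s" "k < N"
  shows "s * k + s div 2 < s * N"
proof -
  have "s * k + s div 2 < s * Suc k" using assms by (auto elim: oddE)
  also have "\<dots> \<le> s * N" using assms by (intro mult_le_mono2) simp
  finally show ?thesis .
qed

text \<open>When the fine image is cut into \<open>s\<close> by \<open>s\<close> blocks, the coarse
  pixel \<open>(k, h)\<close> sits at the centre of block \<open>(k, h)\<close>.\<close>

lemma sample_odd_multiple:
  assumes "odd s" "k < N" "h < M"
  shows "sample (s * N) (s * M) g $$
      (s * k + s div 2, s * h + s div 2) = sample N M g $$ (k, h)"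
  using assms
  by (simp add: sample_def odd_multiple_index_less cheb_zero_odd_multiple)

lemma dim_sample [simp]: "dim_row (sample p q g) = p" "dim_col (sample p q g) = q"
  by (simp_all add: sample_def)

text \<open>This removes interpolation from the problem: only samples of two functions remain to be
  compared.\<close>

lemma sample_lagrange_interp:
  assumes "odd s"
  shows "sample N M (lagrange_interp (s * N) (s * M) g) = sample N M g"
proof (rule eq_matI)
  fix k h assume "k < dim_row (sample N M g)" "h < dim_col (sample N M g)"
  then have kh: "k < N" "h < M" by simp_all
  let ?k = "Suc (s * k + s div 2)" and ?h = "Suc (s * h + s div 2)"
  \<comment> \<open>The coarse evaluation point is written with fine nodes, so that the
    interpolation property applies.\<close>
  have "lagrange_interp (s * N) (s * M) g
        (cheb_zero (s * N) ?k, cheb_zero (s * M) ?h)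
      = g (cheb_zero (s * N) ?k, cheb_zero (s * M) ?h)"
    using odd_multiple_index_less[OF assms kh(1)] odd_multiple_index_less[OF assms kh(2)]
    by (intro lagrange_interp_cheb_zero) simp_all
  then show "sample N M (lagrange_interp (s * N) (s * M) g) $$ (k, h)
      = sample N M g $$ (k, h)"
    using kh by (simp add: sample_def cheb_zero_odd_multiple[OF assms])
qed simp_all

text \<open>Each coarse entry is a fine entry; this settles the case of an uncorrupted
  input.\<close>

lemma sample_eq_odd_multiple:
  assumes "odd s"
    and "sample (s * N) (s * M) g = sample (s * N) (s * M) g'"
  shows "sample N M g = sample N M g'"
proof (rule eq_matI)
  fix k h assume "k < dim_row (sample N M g')" "h < dim_col (sample N M g')"
  then show "sample N M g $$ (k, h) = sample N M g' $$ (k, h)"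
    using sample_odd_multiple[OF assms(1), of k N h M] assms(2) by (metis dim_sample)
qed simp_all

lemma frobenius_norm_square:
  "(frobenius_norm A)\<^sup>2 = (\<Sum>i<dim_row A. \<Sum>j<dim_col A. (A $$ (i, j))\<^sup>2)"
  by (simp add: frobenius_norm_def sum_nonneg)

text \<open>Injectivity of \<open>a\<close> and \<open>b\<close> means that no entry of
  \<open>B\<close> is counted twice, and the squares left out are nonnegative.\<close>

lemma frobenius_norm_subsample_le:
  fixes A B :: "real mat"
  assumes "inj_on a {..<dim_row A}" "a ` {..<dim_row A} \<subseteq> {..<dim_row B}"
    and "inj_on b {..<dim_col A}" "b ` {..<dim_col A} \<subseteq> {..<dim_col B}"
    and "\<And>i j. i < dim_row A \<Longrightarrow> j < dim_col A \<Longrightarrow> A $$ (i, j) = B $$ (a i, b j)"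
  shows "(frobenius_norm A)\<^sup>2 \<le> (frobenius_norm B)\<^sup>2"
proof -
  have "(frobenius_norm A)\<^sup>2 = (\<Sum>i<dim_row A. \<Sum>j<dim_col A. (B $$ (a i, b j))\<^sup>2)"
    by (simp add: frobenius_norm_square assms(5))
  also have "\<dots> = (\<Sum>i\<in>a ` {..<dim_row A}. \<Sum>j\<in>b ` {..<dim_col A}. (B $$ (i, j))\<^sup>2)"
    using assms(1,3) by (simp add: sum.reindex)
  \<comment> \<open>The columns are filled up first, then the rows.\<close>
  also have "\<dots> \<le> (\<Sum>i\<in>a ` {..<dim_row A}. \<Sum>j<dim_col B. (B $$ (i, j))\<^sup>2)"
    using assms(4) by (intro sum_mono sum_mono2) auto
  also have "\<dots> \<le> (\<Sum>i<dim_row B. \<Sum>j<dim_col B. (B $$ (i, j))\<^sup>2)"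
    using assms(2) by (intro sum_mono2) (auto intro: sum_nonneg)
  finally show ?thesis by (simp add: frobenius_norm_square)
qed

lemma frobenius_norm_sample_diff_le:
  assumes "odd s"
  shows "(frobenius_norm (sample N M g - sample N M g'))\<^sup>2 \<le>
    (frobenius_norm (sample (s * N) (s * M) g
      - sample (s * N) (s * M) g'))\<^sup>2"
  using assms
  \<comment> \<open>The block-centre map serves rows and columns alike; it is injective since
    \<open>s > 0\<close>.\<close>
  by (intro frobenius_norm_subsample_le[where a = "\<lambda>k. s * k + s div 2"
        and b = "\<lambda>k. s * k + s div 2"])
    (auto simp: odd_multiple_index_less sample_odd_multiple inj_on_def dest: odd_pos)

lemma frobenius_norm_diff_self [simp]: "frobenius_norm (A - A) = 0"
  by (simp add: frobenius_norm_def)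

lemma MSE_self [simp]: "MSE A A = 0"
  by (simp add: MSE_def)

lemma MSE_rgb_self [simp]: "MSE_rgb A A = 0"
  by (cases A) (simp add: MSE_rgb_def)

lemma img_var_nonneg: "img_var A \<ge> 0"
  by (simp add: img_var_def img_cov_def sum_nonneg)

text \<open>Numerator and denominator coincide for equal images, and the positive constants keep
  them nonzero.\<close>

lemma SSIM_self [simp]: "SSIM A A = 1"
proof -
  have "(img_mean A)\<^sup>2 + (img_mean A)\<^sup>2 + ssim_c1 > 0"
    using zero_le_power2[of "img_mean A"] by (simp add: ssim_c1_def add_nonneg_pos)
  moreover have "img_var A + img_var A + ssim_c2 > 0"
    using img_var_nonneg[of A] by (simp add: ssim_c2_def add_nonneg_pos)
  ultimately show ?thesis
    by (simp add: SSIM_def img_var_def power2_eq_square)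
qed

text \<open>The fine mean divides by \<open>s * s\<close> times the coarse pixel count, which the
  factor on the right compensates exactly.\<close>

lemma MSE_sample_le:
  assumes "odd s"
  shows "MSE (sample N M g) (sample N M g') \<le> (real s)\<^sup>2 *
    MSE (sample (s * N) (s * M) g) (sample (s * N) (s * M) g')"
proof -
  have "s > 0" using assms by (auto intro: Nat.gr0I)
  then show ?thesis
    using frobenius_norm_sample_diff_le[OF assms, of N M g g']
    by (simp add: MSE_def power2_eq_square[of "real s"] divide_right_mono)
qed

text \<open>The three channel bounds add up, and the factor 3 is common to both means.\<close>

lemma MSE_rgb_sample_le:
  assumes "odd s"
  shows "MSE_rgb (sample_rgb N M G) (sample_rgb N M G') \<le> (real s)\<^sup>2 *
    MSE_rgb (sample_rgb (s * N) (s * M) G)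
      (sample_rgb (s * N) (s * M) G')"
proof -
  have "s > 0" using assms by (auto intro: Nat.gr0I)
  note le = frobenius_norm_sample_diff_le[OF assms, of N M]
  have "(frobenius_norm (sample N M (red \<circ> G) - sample N M (red \<circ> G')))\<^sup>2
      + (frobenius_norm (sample N M (green \<circ> G) - sample N M (green \<circ> G')))\<^sup>2
      + (frobenius_norm (sample N M (blue \<circ> G) - sample N M (blue \<circ> G')))\<^sup>2
    \<le> (frobenius_norm (sample (s * N) (s * M) (red \<circ> G) - sample (s * N) (s * M) (red \<circ> G')))\<^sup>2
      + (frobenius_norm (sample (s * N) (s * M) (green \<circ> G) - sample (s * N) (s * M) (green \<circ> G')))\<^sup>2
      + (frobenius_norm (sample (s * N) (s * M) (blue \<circ> G) - sample (s * N) (s * M) (blue \<circ> G')))\<^sup>2"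
    by (intro add_mono le)
  with \<open>s > 0\<close> show ?thesis
    by (simp add: MSE_rgb_def sample_rgb_def power2_eq_square[of "real s"] mult.assoc divide_right_mono)
qed

text \<open>Colour interpolation acts channelwise, so the scalar result applies to each
  projection.\<close>

lemma sample_rgb_lagrange_interp_rgb:
  assumes "odd s"
  shows "sample_rgb N M (lagrange_interp_rgb (s * N) (s * M) G) = sample_rgb N M G"
proof -
  have "red \<circ> lagrange_interp_rgb n m G = lagrange_interp n m (red \<circ> G)"
    "green \<circ> lagrange_interp_rgb n m G = lagrange_interp n m (green \<circ> G)"
    "blue \<circ> lagrange_interp_rgb n m G = lagrange_interp n m (blue \<circ> G)" for n m
    by (auto simp: fun_eq_iff lagrange_interp_rgb_def red_def green_def blue_def)
  then show ?thesis
    using sample_lagrange_interp[OF assms] by (simp add: sample_rgb_def)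
qed

lemma sample_rgb_eq_odd_multiple:
  assumes "odd s"
    and "sample_rgb (s * N) (s * M) G = sample_rgb (s * N) (s * M) G'"
  shows "sample_rgb N M G = sample_rgb N M G'"
  using assms by (auto simp: sample_rgb_def intro: sample_eq_odd_multiple)

theorem proposition4p1:
  fixes n m N M l s :: nat
    and f f' :: "real \<times> real \<Rightarrow> real"
    and F F' :: "real \<times> real \<Rightarrow> rgb"
    and Y :: "rgb \<Rightarrow> real"
  assumes "n \<ge> 1" "m \<ge> 1" "N \<ge> 1" "M \<ge> 1" "l \<ge> 1"
    and "s = 2 * l - 1"
    and "n = (2 * l - 1) * N" and "m = (2 * l - 1) * M"
    and "affine_function Y"
  shows
    "(MSE (sample N M f) (sample N M (lagrange_interp n m f'))
        \<le> (real s)\<^sup>2 * MSE (sample n m f) (sample n m f') \<and>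
      (sample n m f = sample n m f' \<longrightarrow>
        MSE (sample N M f) (sample N M (lagrange_interp n m f')) = 0 \<and>
        SSIM (sample N M f) (sample N M (lagrange_interp n m f')) = 1)) \<and>
     (MSE_rgb (sample_rgb N M F) (sample_rgb N M (lagrange_interp_rgb n m F'))
        \<le> (real s)\<^sup>2 * MSE_rgb (sample_rgb n m F) (sample_rgb n m F') \<and>
      (sample_rgb n m F = sample_rgb n m F' \<longrightarrow>
        MSE_rgb (sample_rgb N M F) (sample_rgb N M (lagrange_interp_rgb n m F')) = 0 \<and>
        SSIM_rgb Y (sample_rgb N M F) (sample_rgb N M (lagrange_interp_rgb n m F')) = 1))"
proof -
  \<comment> \<open>Subtraction on \<open>nat\<close> truncates: \<open>l \<ge> 1\<close> makes
    \<open>2 * l - 1\<close> odd, whereas \<open>l = 0\<close> would give 0.\<close>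
  have s: "odd s" "n = s * N" "m = s * M" using assms by simp_all
  have interp: "sample N M (lagrange_interp n m f') = sample N M f'"
    "sample_rgb N M (lagrange_interp_rgb n m F') = sample_rgb N M F'"
    using s by (simp_all add: sample_lagrange_interp sample_rgb_lagrange_interp_rgb)
  have "MSE (sample N M f) (sample N M f') \<le> (real s)\<^sup>2 * MSE (sample n m f) (sample n m f')"
    "MSE_rgb (sample_rgb N M F) (sample_rgb N M F')
      \<le> (real s)\<^sup>2 * MSE_rgb (sample_rgb n m F) (sample_rgb n m F')"
    unfolding s(2,3) using s(1) by (rule MSE_sample_le MSE_rgb_sample_le)+
  moreover have "sample N M f = sample N M f'" if "sample n m f = sample n m f'"
    using that sample_eq_odd_multiple[OF s(1), of N M f f'] s by simp
  moreover have "sample_rgb N M F = sample_rgb N M F'" if "sample_rgb n m F = sample_rgb n m F'"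
    using that sample_rgb_eq_odd_multiple[OF s(1), of N M F F'] s by simp
  \<comment> \<open>Equal colour images have equal luma channels, so \<open>SSIM_rgb\<close>
    compares an image with itself.\<close>
  ultimately show ?thesis
    unfolding interp by (auto simp: SSIM_rgb_def)
qed

end
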